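(* Let $\mathcal{L}$ be a finite FOLDS signature. Then $\mathrm{Struc}(\mathcal{L})$ is a closed type, i.e. the judgment $\vdash\mathrm{Struc}(\mathcal{L})\ \mathbf{Type}$ is derivable in MLTT.
   Context: A FOLDS signature is an inverse category $\mathcal{L}$ (skeletal, no non-identity endomorphisms, each object the domain of finitely many arrows) with a proper order: a partial order $<$ on objects with $K_f<K$ for every non-identity $f\colon K\to K_f$, and a partial order on arrows with $f<g$ whenever $\operatorname{cod}f<\operatorname{cod}g$; $K/\!/\mathcal{L}$ is the set of non-identity arrows with domain $K$, $K_f$ is the codomain of $f$, and indexed tuples are listed in increasing order. It is finite if it has finitely many objects and arrows. MLTT here is intensional Martin-Löf type theory with $\Pi$, $\Sigma$, the unit type $\mathbf{1}$ (with term $*$), and a universe à la Tarski $\mathcal{U}$ with decoding $\mathrm{El}$ (and $+,\mathbf{0}$). Let $K_1<\dots<K_m$ be the objects of $\mathcal{L}$. Type-theoretic variables are named by arrows of $\mathcal{L}$ (arrows that are equal as composites name the same variable). For an object $K$ with $K/\!/\mathcal{L}=\{f_1<\dots<f_n\}$ define $T_K:=\Pi(f_1:\mathrm{El}(\mathrm{app}[K_{f_1}(pf_1)_{p\in K_{f_1}/\!/\mathcal{L}}]))\cdots(f_n:\mathrm{El}(\mathrm{app}[K_{f_n}(pf_n)_{p\in K_{f_n}/\!/\mathcal{L}}]))\ \mathcal{U}$, where $\mathrm{app}[K'(q_1,\dots,q_k)]$ is the iterated application $\mathrm{app}(q_k,\dots\mathrm{app}(q_1,K')\dots)$ of the variable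 $K'$ to the variables $q_1,\dots,q_k$, and $\mathrm{app}[K'\,\epsilon]:=\mathrm{app}( *,K')$ when $K'/\!/\mathcal{L}$ is empty; if $K/\!/\mathcal{L}=\varnothing$ then $T_K:=\mathbf{1}\to\mathcal{U}$. Then $\mathrm{Struc}(\mathcal{L}):=\Sigma(K_1:T_{K_1})\cdots(K_m:T_{K_m})$ (iterated $\Sigma$-type). For example, for the signature with objects $O<A$ and two arrows $A\to O$, $\mathrm{Struc}(\mathcal{L})$ is, up to the obvious notational identifications, $\Sigma(O:\mathcal{U})(A:O\to O\to\mathcal{U})$. *)

theory Defs
  imports Main
begin

section \<open>Finite FOLDS signatures\<close>

record ('o, 'a) signature =
  Obj :: "'o set"
  Arr :: "'a set"
  arr_dom :: "'a \<Rightarrow> 'o"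
  arr_cod :: "'a \<Rightarrow> 'o"
  ident :: "'o \<Rightarrow> 'a"
  arr_comp :: "'a \<Rightarrow> 'a \<Rightarrow> 'a"   \<comment> \<open>\<open>arr_comp L p f\<close> is \<open>p\<close> after \<open>f\<close>\<close>
  obj_less :: "'o \<Rightarrow> 'o \<Rightarrow> bool"
  arr_less :: "'a \<Rightarrow> 'a \<Rightarrow> bool"

locale category =
  fixes L :: "('o, 'a) signature"
  assumes dom_in: "f \<in> Arr L \<Longrightarrow> arr_dom L f \<in> Obj L"
    and cod_in: "f \<in> Arr L \<Longrightarrow> arr_cod L f \<in> Obj L"
    and ident_in: "K \<in> Obj L \<Longrightarrow> ident L K \<in> Arr L"
    and dom_ident: "K \<in> Obj L \<Longrightarrow> arr_dom L (ident L K) = K"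
    and cod_ident: "K \<in> Obj L \<Longrightarrow> arr_cod L (ident L K) = K"
    and comp_in: "\<lbrakk>f \<in> Arr L; p \<in> Arr L; arr_cod L f = arr_dom L p\<rbrakk>
          \<Longrightarrow> arr_comp L p f \<in> Arr L"
    and dom_comp: "\<lbrakk>f \<in> Arr L; p \<in> Arr L; arr_cod L f = arr_dom L p\<rbrakk>
          \<Longrightarrow> arr_dom L (arr_comp L p f) = arr_dom L f"
    and cod_comp: "\<lbrakk>f \<in> Arr L; p \<in> Arr L; arr_cod L f = arr_dom L p\<rbrakk>
          \<Longrightarrow> arr_cod L (arr_comp L p f) = arr_cod L p"
    and ident_comp: "f \<in> Arr L \<Longrightarrow> arr_comp L (ident L (arr_cod L f)) f = f"
    and comp_ident: "f \<in> Arr L \<Longrightarrow> arr_comp L f (ident L (arr_dom L f)) = f"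
    and comp_assoc: "\<lbrakk>f \<in> Arr L; p \<in> Arr L; q \<in> Arr L;
          arr_cod L f = arr_dom L p; arr_cod L p = arr_dom L q\<rbrakk>
          \<Longrightarrow> arr_comp L q (arr_comp L p f) = arr_comp L (arr_comp L q p) f"

locale inverse_category = category L for L :: "('o, 'a) signature" +
  assumes skeletal: "\<lbrakk>f \<in> Arr L; g \<in> Arr L;
          arr_dom L g = arr_cod L f; arr_cod L g = arr_dom L f;
          arr_comp L g f = ident L (arr_dom L f);
          arr_comp L f g = ident L (arr_cod L f)\<rbrakk>
          \<Longrightarrow> arr_dom L f = arr_cod L f"
    and no_endo: "\<lbrakk>f \<in> Arr L; arr_dom L f = arr_cod L f\<rbrakk>
          \<Longrightarrow> f = ident L (arr_dom L f)"
    and finite_fan_out: "K \<in> Obj L \<Longrightarrow> finite {f \<in> Arr L. arr_dom L f = K}"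

locale folds_signature = inverse_category L for L :: "('o, 'a) signature" +
  assumes obj_less_irrefl: "irreflp_on (Obj L) (obj_less L)"
    and obj_less_trans: "transp_on (Obj L) (obj_less L)"
    and cod_less_dom: "\<lbrakk>f \<in> Arr L; f \<noteq> ident L (arr_dom L f)\<rbrakk>
          \<Longrightarrow> obj_less L (arr_cod L f) (arr_dom L f)"
    and arr_less_irrefl: "irreflp_on (Arr L) (arr_less L)"
    and arr_less_trans: "transp_on (Arr L) (arr_less L)"
    and arr_less_cod: "\<lbrakk>f \<in> Arr L; g \<in> Arr L; obj_less L (arr_cod L f) (arr_cod L g)\<rbrakk>
          \<Longrightarrow> arr_less L f g"

locale finite_folds_signature = folds_signature L for L :: "('o, 'a) signature" +
  assumes finite_Obj: "finite (Obj L)"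
    and finite_Arr: "finite (Arr L)"

text \<open>The set \<open>K//L\<close>.\<close>

definition proper_arrows :: "('o, 'a) signature \<Rightarrow> 'o \<Rightarrow> 'a set" where
  "proper_arrows L K = {f \<in> Arr L. arr_dom L f = K \<and> f \<noteq> ident L K}"

text \<open>The orders of a signature are only partial, so an increasing listing is a linear extension;
  it is unique when the order is total.\<close>

definition increasing_listing :: "('b \<Rightarrow> 'b \<Rightarrow> bool) \<Rightarrow> 'b set \<Rightarrow> 'b list \<Rightarrow> bool" where
  "increasing_listing lt A xs \<longleftrightarrow>
     distinct xs \<and> set xs = A \<and> sorted_wrt (\<lambda>x y. \<not> lt y x) xs"

lemma increasing_listing_exists:
  assumes "finite A" "irreflp_on A lt" "transp_on A lt"
  shows "\<exists>xs. increasing_listing lt A xs"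
  using assms
proof (induction "card A" arbitrary: A)
  case 0
  then show ?case by (auto simp: increasing_listing_def)
next
  case (Suc n)
  have "asymp_on A lt"
    using Suc.prems by (meson asymp_on_iff_irreflp_on_if_transp_on)
  then obtain m where m: "m \<in> A" "\<And>x. x \<in> A \<Longrightarrow> \<not> lt x m"
    using Finite_Set.bex_min_element[of A lt] Suc by (metis asymp_onD card.empty nat.distinct(1))
  obtain xs where "increasing_listing lt (A - {m}) xs"
    using Suc.hyps(1)[of "A - {m}"] Suc m
    by (metis Diff_subset card_Diff_singleton diff_Suc_1 finite_Diff irreflp_on_subset transp_on_subset)
  then have "increasing_listing lt A (m # xs)"
    using m by (auto simp: increasing_listing_def)
  then show ?case ..
qed


section \<open>Raw expressions of Martin-Loef type theory\<close>

text \<open>Expressions up to renaming of bound variables, in locally nameless style: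
  free variables are names, and \<open>Bnd n\<close> refers to the \<open>n\<close>-th enclosing \<open>Abs\<close>.
  \<open>Abs\<close> is the only binder; an operator that binds \<open>k\<close> variables in an argument gets that
  argument as a \<open>k\<close>-fold \<open>Abs\<close>.\<close>

datatype operator =
    OPi | OLam | OApp
  | OSigma | OPair | OIndSigma
  | OUnit | OStar | OIndUnit
  | OEmpty | OIndEmpty
  | OSum | OInl | OInr | OIndSum
  | OId | ORefl | OIndId
  | OU | OEl | OCodePi | OCodeSigma | OCodeUnit | OCodeEmpty | OCodeSum | OCodeId

datatype 'v expr =
    Var 'v
  | Bnd nat
  | Abs "'v expr"
  | Op operator "'v expr list"

primrec close_at :: "nat \<Rightarrow> 'v \<Rightarrow> 'v expr \<Rightarrow> 'v expr" where
  "close_at k x (Var y) = (if y = x then Bnd k else Var y)"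
| "close_at k x (Bnd n) = Bnd n"
| "close_at k x (Abs e) = Abs (close_at (Suc k) x e)"
| "close_at k x (Op c es) = Op c (map (close_at k x) es)"

primrec open_at :: "nat \<Rightarrow> 'v expr \<Rightarrow> 'v expr \<Rightarrow> 'v expr" where
  "open_at k u (Var y) = Var y"
| "open_at k u (Bnd n) = (if n = k then u else Bnd n)"
| "open_at k u (Abs e) = Abs (open_at (Suc k) u e)"
| "open_at k u (Op c es) = Op c (map (open_at k u) es)"

text \<open>\<open>subst x u e\<close> is \<open>e[u/x]\<close>. No capture can occur, since \<open>u\<close> has no dangling \<open>Bnd\<close>.\<close>

primrec subst :: "'v \<Rightarrow> 'v expr \<Rightarrow> 'v expr \<Rightarrow> 'v expr" where
  "subst x u (Var y) = (if y = x then u else Var y)"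
| "subst x u (Bnd n) = Bnd n"
| "subst x u (Abs e) = Abs (subst x u e)"
| "subst x u (Op c es) = Op c (map (subst x u) es)"

definition bind :: "'v \<Rightarrow> 'v expr \<Rightarrow> 'v expr" where
  "bind x e = Abs (close_at 0 x e)"

abbreviation "Pi_ty A B \<equiv> Op OPi [A, B]"
abbreviation "lam A t \<equiv> Op OLam [A, t]"
text \<open>\<open>app a t\<close> is the application of the function \<open>t\<close> to the argument \<open>a\<close>, in this order.\<close>
abbreviation "app a t \<equiv> Op OApp [a, t]"
abbreviation "Sigma_ty A B \<equiv> Op OSigma [A, B]"
abbreviation "pair a b \<equiv> Op OPair [a, b]"
abbreviation "ind_Sigma C c p \<equiv> Op OIndSigma [C, c, p]"
abbreviation "Unit_ty \<equiv> Op OUnit []"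
abbreviation "star \<equiv> Op OStar []"
abbreviation "ind_Unit C c p \<equiv> Op OIndUnit [C, c, p]"
abbreviation "Empty_ty \<equiv> Op OEmpty []"
abbreviation "ind_Empty C p \<equiv> Op OIndEmpty [C, p]"
abbreviation "Sum_ty A B \<equiv> Op OSum [A, B]"
abbreviation "inl a \<equiv> Op OInl [a]"
abbreviation "inr b \<equiv> Op OInr [b]"
abbreviation "ind_Sum C c d p \<equiv> Op OIndSum [C, c, d, p]"
abbreviation "Id_ty A a b \<equiv> Op OId [A, a, b]"
abbreviation "refl_tm a \<equiv> Op ORefl [a]"
abbreviation "ind_Id C c a b p \<equiv> Op OIndId [C, c, a, b, p]"
abbreviation "U_ty \<equiv> Op OU []"
abbreviation "El a \<equiv> Op OEl [a]"
abbreviation "code_Pi a b \<equiv> Op OCodePi [a, b]"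
abbreviation "code_Sigma a b \<equiv> Op OCodeSigma [a, b]"
abbreviation "code_Unit \<equiv> Op OCodeUnit []"
abbreviation "code_Empty \<equiv> Op OCodeEmpty []"
abbreviation "code_Sum a b \<equiv> Op OCodeSum [a, b]"
abbreviation "code_Id a t u \<equiv> Op OCodeId [a, t, u]"

abbreviation arrow_ty :: "'v expr \<Rightarrow> 'v expr \<Rightarrow> 'v expr" where
  "arrow_ty A B \<equiv> Pi_ty A (Abs B)"


section \<open>Derivable judgments\<close>

datatype 'e jdgmt =
    IsCtx
  | IsType 'e
  | EqType 'e 'e
  | HasType 'e 'e      \<comment> \<open>\<open>HasType a A\<close> is \<open>a : A\<close>\<close>
  | EqTerm 'e 'e 'e    \<comment> \<open>\<open>EqTerm a b A\<close> is \<open>a \<equiv> b : A\<close>\<close>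

type_synonym 'v ctxt = "('v \<times> 'v expr) list"

abbreviation ext :: "'v ctxt \<Rightarrow> 'v \<Rightarrow> 'v expr \<Rightarrow> 'v ctxt" where
  "ext \<Gamma> x A \<equiv> \<Gamma> @ [(x, A)]"

inductive derivable :: "'v ctxt \<Rightarrow> 'v expr jdgmt \<Rightarrow> bool"  (infix "\<turnstile>" 50) where
  ctx_empty: "[] \<turnstile> IsCtx"
| ctx_ext: "\<lbrakk>\<Gamma> \<turnstile> IsType A; x \<notin> fst ` set \<Gamma>\<rbrakk> \<Longrightarrow> ext \<Gamma> x A \<turnstile> IsCtx"
| var: "\<lbrakk>\<Gamma> \<turnstile> IsCtx; (x, A) \<in> set \<Gamma>\<rbrakk> \<Longrightarrow> \<Gamma> \<turnstile> HasType (Var x) A"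
| weakening: "\<lbrakk>\<Gamma> @ \<Delta> \<turnstile> J; \<Gamma> \<turnstile> IsType A; x \<notin> fst ` set (\<Gamma> @ \<Delta>)\<rbrakk>
    \<Longrightarrow> ext \<Gamma> x A @ \<Delta> \<turnstile> J"
| substitution: "\<lbrakk>ext \<Gamma> x A @ \<Delta> \<turnstile> J; \<Gamma> \<turnstile> HasType a A\<rbrakk>
    \<Longrightarrow> \<Gamma> @ map (\<lambda>(y, B). (y, subst x a B)) \<Delta> \<turnstile> map_jdgmt (subst x a) J"
| ty_refl: "\<Gamma> \<turnstile> IsType A \<Longrightarrow> \<Gamma> \<turnstile> EqType A A"
| ty_sym: "\<Gamma> \<turnstile> EqType A B \<Longrightarrow> \<Gamma> \<turnstile> EqType B A"
| ty_trans: "\<lbrakk>\<Gamma> \<turnstile> EqType A B; \<Gamma> \<turnstile> EqType B C\<rbrakk> \<Longrightarrow> \<Gamma> \<turnstile> EqType A C"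
| tm_refl: "\<Gamma> \<turnstile> HasType a A \<Longrightarrow> \<Gamma> \<turnstile> EqTerm a a A"
| tm_sym: "\<Gamma> \<turnstile> EqTerm a b A \<Longrightarrow> \<Gamma> \<turnstile> EqTerm b a A"
| tm_trans: "\<lbrakk>\<Gamma> \<turnstile> EqTerm a b A; \<Gamma> \<turnstile> EqTerm b c A\<rbrakk> \<Longrightarrow> \<Gamma> \<turnstile> EqTerm a c A"
| conv: "\<lbrakk>\<Gamma> \<turnstile> HasType a A; \<Gamma> \<turnstile> EqType A B\<rbrakk> \<Longrightarrow> \<Gamma> \<turnstile> HasType a B"
| conv_eq: "\<lbrakk>\<Gamma> \<turnstile> EqTerm a b A; \<Gamma> \<turnstile> EqType A B\<rbrakk> \<Longrightarrow> \<Gamma> \<turnstile> EqTerm a b B"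
| Pi_form: "\<lbrakk>\<Gamma> \<turnstile> IsType A; ext \<Gamma> x A \<turnstile> IsType B\<rbrakk> \<Longrightarrow> \<Gamma> \<turnstile> IsType (Pi_ty A (bind x B))"
| Pi_form_eq: "\<lbrakk>\<Gamma> \<turnstile> EqType A A'; ext \<Gamma> x A \<turnstile> EqType B B'\<rbrakk>
    \<Longrightarrow> \<Gamma> \<turnstile> EqType (Pi_ty A (bind x B)) (Pi_ty A' (bind x B'))"
| Pi_intro: "ext \<Gamma> x A \<turnstile> HasType t B \<Longrightarrow> \<Gamma> \<turnstile> HasType (lam A (bind x t)) (Pi_ty A (bind x B))"
| Pi_intro_eq: "\<lbrakk>\<Gamma> \<turnstile> EqType A A'; ext \<Gamma> x A \<turnstile> EqTerm t t' B\<rbrakk>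
    \<Longrightarrow> \<Gamma> \<turnstile> EqTerm (lam A (bind x t)) (lam A' (bind x t')) (Pi_ty A (bind x B))"
| Pi_elim: "\<lbrakk>\<Gamma> \<turnstile> HasType t (Pi_ty A (Abs B)); \<Gamma> \<turnstile> HasType a A\<rbrakk>
    \<Longrightarrow> \<Gamma> \<turnstile> HasType (app a t) (open_at 0 a B)"
| Pi_elim_eq: "\<lbrakk>\<Gamma> \<turnstile> EqTerm t t' (Pi_ty A (Abs B)); \<Gamma> \<turnstile> EqTerm a a' A\<rbrakk>
    \<Longrightarrow> \<Gamma> \<turnstile> EqTerm (app a t) (app a' t') (open_at 0 a B)"
| Pi_comp: "\<lbrakk>ext \<Gamma> x A \<turnstile> HasType t B; \<Gamma> \<turnstile> HasType a A\<rbrakk>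
    \<Longrightarrow> \<Gamma> \<turnstile> EqTerm (app a (lam A (bind x t))) (subst x a t) (subst x a B)"
| Sigma_form: "\<lbrakk>\<Gamma> \<turnstile> IsType A; ext \<Gamma> x A \<turnstile> IsType B\<rbrakk> \<Longrightarrow> \<Gamma> \<turnstile> IsType (Sigma_ty A (bind x B))"
| Sigma_form_eq: "\<lbrakk>\<Gamma> \<turnstile> EqType A A'; ext \<Gamma> x A \<turnstile> EqType B B'\<rbrakk>
    \<Longrightarrow> \<Gamma> \<turnstile> EqType (Sigma_ty A (bind x B)) (Sigma_ty A' (bind x B'))"
| Sigma_intro: "\<lbrakk>ext \<Gamma> x A \<turnstile> IsType B; \<Gamma> \<turnstile> HasType a A; \<Gamma> \<turnstile> HasType b (subst x a B)\<rbrakk>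
    \<Longrightarrow> \<Gamma> \<turnstile> HasType (pair a b) (Sigma_ty A (bind x B))"
| Sigma_intro_eq: "\<lbrakk>ext \<Gamma> x A \<turnstile> IsType B; \<Gamma> \<turnstile> EqTerm a a' A; \<Gamma> \<turnstile> EqTerm b b' (subst x a B)\<rbrakk>
    \<Longrightarrow> \<Gamma> \<turnstile> EqTerm (pair a b) (pair a' b') (Sigma_ty A (bind x B))"
| Sigma_elim: "\<lbrakk>ext \<Gamma> z (Sigma_ty A (bind x B)) \<turnstile> IsType C;
      ext (ext \<Gamma> x A) y B \<turnstile> HasType c (subst z (pair (Var x) (Var y)) C);
      \<Gamma> \<turnstile> HasType p (Sigma_ty A (bind x B))\<rbrakk>
    \<Longrightarrow> \<Gamma> \<turnstile> HasType (ind_Sigma (bind z C) (bind x (bind y c)) p) (subst z p C)"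
| Sigma_elim_eq: "\<lbrakk>ext \<Gamma> z (Sigma_ty A (bind x B)) \<turnstile> EqType C C';
      ext (ext \<Gamma> x A) y B \<turnstile> EqTerm c c' (subst z (pair (Var x) (Var y)) C);
      \<Gamma> \<turnstile> EqTerm p p' (Sigma_ty A (bind x B))\<rbrakk>
    \<Longrightarrow> \<Gamma> \<turnstile> EqTerm (ind_Sigma (bind z C) (bind x (bind y c)) p)
          (ind_Sigma (bind z C') (bind x (bind y c')) p') (subst z p C)"
| Sigma_comp: "\<lbrakk>ext \<Gamma> z (Sigma_ty A (bind x B)) \<turnstile> IsType C;
      ext (ext \<Gamma> x A) y B \<turnstile> HasType c (subst z (pair (Var x) (Var y)) C);
      \<Gamma> \<turnstile> HasType a A; \<Gamma> \<turnstile> HasType b (subst x a B)\<rbrakk>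
    \<Longrightarrow> \<Gamma> \<turnstile> EqTerm (ind_Sigma (bind z C) (bind x (bind y c)) (pair a b))
          (subst x a (subst y b c)) (subst z (pair a b) C)"
| Unit_form: "\<Gamma> \<turnstile> IsCtx \<Longrightarrow> \<Gamma> \<turnstile> IsType Unit_ty"
| Unit_intro: "\<Gamma> \<turnstile> IsCtx \<Longrightarrow> \<Gamma> \<turnstile> HasType star Unit_ty"
| Unit_elim: "\<lbrakk>ext \<Gamma> z Unit_ty \<turnstile> IsType C; \<Gamma> \<turnstile> HasType c (subst z star C); \<Gamma> \<turnstile> HasType p Unit_ty\<rbrakk>
    \<Longrightarrow> \<Gamma> \<turnstile> HasType (ind_Unit (bind z C) c p) (subst z p C)"
| Unit_elim_eq: "\<lbrakk>ext \<Gamma> z Unit_ty \<turnstile> EqType C C'; \<Gamma> \<turnstile> EqTerm c c' (subst z star C);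
      \<Gamma> \<turnstile> EqTerm p p' Unit_ty\<rbrakk>
    \<Longrightarrow> \<Gamma> \<turnstile> EqTerm (ind_Unit (bind z C) c p) (ind_Unit (bind z C') c' p') (subst z p C)"
| Unit_comp: "\<lbrakk>ext \<Gamma> z Unit_ty \<turnstile> IsType C; \<Gamma> \<turnstile> HasType c (subst z star C)\<rbrakk>
    \<Longrightarrow> \<Gamma> \<turnstile> EqTerm (ind_Unit (bind z C) c star) c (subst z star C)"
| Empty_form: "\<Gamma> \<turnstile> IsCtx \<Longrightarrow> \<Gamma> \<turnstile> IsType Empty_ty"
| Empty_elim: "\<lbrakk>ext \<Gamma> z Empty_ty \<turnstile> IsType C; \<Gamma> \<turnstile> HasType p Empty_ty\<rbrakk>
    \<Longrightarrow> \<Gamma> \<turnstile> HasType (ind_Empty (bind z C) p) (subst z p C)"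
| Empty_elim_eq: "\<lbrakk>ext \<Gamma> z Empty_ty \<turnstile> EqType C C'; \<Gamma> \<turnstile> EqTerm p p' Empty_ty\<rbrakk>
    \<Longrightarrow> \<Gamma> \<turnstile> EqTerm (ind_Empty (bind z C) p) (ind_Empty (bind z C') p') (subst z p C)"
| Sum_form: "\<lbrakk>\<Gamma> \<turnstile> IsType A; \<Gamma> \<turnstile> IsType B\<rbrakk> \<Longrightarrow> \<Gamma> \<turnstile> IsType (Sum_ty A B)"
| Sum_form_eq: "\<lbrakk>\<Gamma> \<turnstile> EqType A A'; \<Gamma> \<turnstile> EqType B B'\<rbrakk> \<Longrightarrow> \<Gamma> \<turnstile> EqType (Sum_ty A B) (Sum_ty A' B')"
| Sum_introl: "\<lbrakk>\<Gamma> \<turnstile> HasType a A; \<Gamma> \<turnstile> IsType B\<rbrakk> \<Longrightarrow> \<Gamma> \<turnstile> HasType (inl a) (Sum_ty A B)"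
| Sum_introl_eq: "\<lbrakk>\<Gamma> \<turnstile> EqTerm a a' A; \<Gamma> \<turnstile> IsType B\<rbrakk> \<Longrightarrow> \<Gamma> \<turnstile> EqTerm (inl a) (inl a') (Sum_ty A B)"
| Sum_intror: "\<lbrakk>\<Gamma> \<turnstile> IsType A; \<Gamma> \<turnstile> HasType b B\<rbrakk> \<Longrightarrow> \<Gamma> \<turnstile> HasType (inr b) (Sum_ty A B)"
| Sum_intror_eq: "\<lbrakk>\<Gamma> \<turnstile> IsType A; \<Gamma> \<turnstile> EqTerm b b' B\<rbrakk> \<Longrightarrow> \<Gamma> \<turnstile> EqTerm (inr b) (inr b') (Sum_ty A B)"
| Sum_elim: "\<lbrakk>ext \<Gamma> z (Sum_ty A B) \<turnstile> IsType C;
      ext \<Gamma> x A \<turnstile> HasType c (subst z (inl (Var x)) C);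
      ext \<Gamma> y B \<turnstile> HasType d (subst z (inr (Var y)) C);
      \<Gamma> \<turnstile> HasType p (Sum_ty A B)\<rbrakk>
    \<Longrightarrow> \<Gamma> \<turnstile> HasType (ind_Sum (bind z C) (bind x c) (bind y d) p) (subst z p C)"
| Sum_elim_eq: "\<lbrakk>ext \<Gamma> z (Sum_ty A B) \<turnstile> EqType C C';
      ext \<Gamma> x A \<turnstile> EqTerm c c' (subst z (inl (Var x)) C);
      ext \<Gamma> y B \<turnstile> EqTerm d d' (subst z (inr (Var y)) C);
      \<Gamma> \<turnstile> EqTerm p p' (Sum_ty A B)\<rbrakk>
    \<Longrightarrow> \<Gamma> \<turnstile> EqTerm (ind_Sum (bind z C) (bind x c) (bind y d) p)
          (ind_Sum (bind z C') (bind x c') (bind y d') p') (subst z p C)"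
| Sum_compl: "\<lbrakk>ext \<Gamma> z (Sum_ty A B) \<turnstile> IsType C;
      ext \<Gamma> x A \<turnstile> HasType c (subst z (inl (Var x)) C);
      ext \<Gamma> y B \<turnstile> HasType d (subst z (inr (Var y)) C);
      \<Gamma> \<turnstile> HasType a A\<rbrakk>
    \<Longrightarrow> \<Gamma> \<turnstile> EqTerm (ind_Sum (bind z C) (bind x c) (bind y d) (inl a))
          (subst x a c) (subst z (inl a) C)"
| Sum_compr: "\<lbrakk>ext \<Gamma> z (Sum_ty A B) \<turnstile> IsType C;
      ext \<Gamma> x A \<turnstile> HasType c (subst z (inl (Var x)) C);
      ext \<Gamma> y B \<turnstile> HasType d (subst z (inr (Var y)) C);
      \<Gamma> \<turnstile> HasType b B\<rbrakk>
    \<Longrightarrow> \<Gamma> \<turnstile> EqTerm (ind_Sum (bind z C) (bind x c) (bind y d) (inr b))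
          (subst y b d) (subst z (inr b) C)"
| Id_form: "\<lbrakk>\<Gamma> \<turnstile> IsType A; \<Gamma> \<turnstile> HasType a A; \<Gamma> \<turnstile> HasType b A\<rbrakk> \<Longrightarrow> \<Gamma> \<turnstile> IsType (Id_ty A a b)"
| Id_form_eq: "\<lbrakk>\<Gamma> \<turnstile> EqType A A'; \<Gamma> \<turnstile> EqTerm a a' A; \<Gamma> \<turnstile> EqTerm b b' A\<rbrakk>
    \<Longrightarrow> \<Gamma> \<turnstile> EqType (Id_ty A a b) (Id_ty A' a' b')"
| Id_intro: "\<Gamma> \<turnstile> HasType a A \<Longrightarrow> \<Gamma> \<turnstile> HasType (refl_tm a) (Id_ty A a a)"
| Id_intro_eq: "\<Gamma> \<turnstile> EqTerm a a' A \<Longrightarrow> \<Gamma> \<turnstile> EqTerm (refl_tm a) (refl_tm a') (Id_ty A a a)"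
| Id_elim: "\<lbrakk>ext (ext (ext \<Gamma> x A) y A) q (Id_ty A (Var x) (Var y)) \<turnstile> IsType C;
      ext \<Gamma> z A \<turnstile> HasType c (subst x (Var z) (subst y (Var z) (subst q (refl_tm (Var z)) C)));
      \<Gamma> \<turnstile> HasType a A; \<Gamma> \<turnstile> HasType b A; \<Gamma> \<turnstile> HasType p (Id_ty A a b)\<rbrakk>
    \<Longrightarrow> \<Gamma> \<turnstile> HasType (ind_Id (bind x (bind y (bind q C))) (bind z c) a b p)
          (subst x a (subst y b (subst q p C)))"
| Id_elim_eq: "\<lbrakk>ext (ext (ext \<Gamma> x A) y A) q (Id_ty A (Var x) (Var y)) \<turnstile> EqType C C';
      ext \<Gamma> z A \<turnstile> EqTerm c c' (subst x (Var z) (subst y (Var z) (subst q (refl_tm (Var z)) C)));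
      \<Gamma> \<turnstile> EqTerm a a' A; \<Gamma> \<turnstile> EqTerm b b' A; \<Gamma> \<turnstile> EqTerm p p' (Id_ty A a b)\<rbrakk>
    \<Longrightarrow> \<Gamma> \<turnstile> EqTerm (ind_Id (bind x (bind y (bind q C))) (bind z c) a b p)
          (ind_Id (bind x (bind y (bind q C'))) (bind z c') a' b' p')
          (subst x a (subst y b (subst q p C)))"
| Id_comp: "\<lbrakk>ext (ext (ext \<Gamma> x A) y A) q (Id_ty A (Var x) (Var y)) \<turnstile> IsType C;
      ext \<Gamma> z A \<turnstile> HasType c (subst x (Var z) (subst y (Var z) (subst q (refl_tm (Var z)) C)));
      \<Gamma> \<turnstile> HasType a A\<rbrakk>
    \<Longrightarrow> \<Gamma> \<turnstile> EqTerm (ind_Id (bind x (bind y (bind q C))) (bind z c) a a (refl_tm a))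
          (subst z a c) (subst x a (subst y a (subst q (refl_tm a) C)))"
| U_form: "\<Gamma> \<turnstile> IsCtx \<Longrightarrow> \<Gamma> \<turnstile> IsType U_ty"
| El_form: "\<Gamma> \<turnstile> HasType a U_ty \<Longrightarrow> \<Gamma> \<turnstile> IsType (El a)"
| El_form_eq: "\<Gamma> \<turnstile> EqTerm a a' U_ty \<Longrightarrow> \<Gamma> \<turnstile> EqType (El a) (El a')"
| code_Pi: "\<lbrakk>\<Gamma> \<turnstile> HasType a U_ty; ext \<Gamma> x (El a) \<turnstile> HasType b U_ty\<rbrakk>
    \<Longrightarrow> \<Gamma> \<turnstile> HasType (code_Pi a (bind x b)) U_ty"
| code_Pi_eq: "\<lbrakk>\<Gamma> \<turnstile> EqTerm a a' U_ty; ext \<Gamma> x (El a) \<turnstile> EqTerm b b' U_ty\<rbrakk>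
    \<Longrightarrow> \<Gamma> \<turnstile> EqTerm (code_Pi a (bind x b)) (code_Pi a' (bind x b')) U_ty"
| El_Pi: "\<lbrakk>\<Gamma> \<turnstile> HasType a U_ty; ext \<Gamma> x (El a) \<turnstile> HasType b U_ty\<rbrakk>
    \<Longrightarrow> \<Gamma> \<turnstile> EqType (El (code_Pi a (bind x b))) (Pi_ty (El a) (bind x (El b)))"
| code_Sigma: "\<lbrakk>\<Gamma> \<turnstile> HasType a U_ty; ext \<Gamma> x (El a) \<turnstile> HasType b U_ty\<rbrakk>
    \<Longrightarrow> \<Gamma> \<turnstile> HasType (code_Sigma a (bind x b)) U_ty"
| code_Sigma_eq: "\<lbrakk>\<Gamma> \<turnstile> EqTerm a a' U_ty; ext \<Gamma> x (El a) \<turnstile> EqTerm b b' U_ty\<rbrakk>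
    \<Longrightarrow> \<Gamma> \<turnstile> EqTerm (code_Sigma a (bind x b)) (code_Sigma a' (bind x b')) U_ty"
| El_Sigma: "\<lbrakk>\<Gamma> \<turnstile> HasType a U_ty; ext \<Gamma> x (El a) \<turnstile> HasType b U_ty\<rbrakk>
    \<Longrightarrow> \<Gamma> \<turnstile> EqType (El (code_Sigma a (bind x b))) (Sigma_ty (El a) (bind x (El b)))"
| code_Unit: "\<Gamma> \<turnstile> IsCtx \<Longrightarrow> \<Gamma> \<turnstile> HasType code_Unit U_ty"
| El_Unit: "\<Gamma> \<turnstile> IsCtx \<Longrightarrow> \<Gamma> \<turnstile> EqType (El code_Unit) Unit_ty"
| code_Empty: "\<Gamma> \<turnstile> IsCtx \<Longrightarrow> \<Gamma> \<turnstile> HasType code_Empty U_ty"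
| El_Empty: "\<Gamma> \<turnstile> IsCtx \<Longrightarrow> \<Gamma> \<turnstile> EqType (El code_Empty) Empty_ty"
| code_Sum: "\<lbrakk>\<Gamma> \<turnstile> HasType a U_ty; \<Gamma> \<turnstile> HasType b U_ty\<rbrakk> \<Longrightarrow> \<Gamma> \<turnstile> HasType (code_Sum a b) U_ty"
| code_Sum_eq: "\<lbrakk>\<Gamma> \<turnstile> EqTerm a a' U_ty; \<Gamma> \<turnstile> EqTerm b b' U_ty\<rbrakk>
    \<Longrightarrow> \<Gamma> \<turnstile> EqTerm (code_Sum a b) (code_Sum a' b') U_ty"
| El_Sum: "\<lbrakk>\<Gamma> \<turnstile> HasType a U_ty; \<Gamma> \<turnstile> HasType b U_ty\<rbrakk>
    \<Longrightarrow> \<Gamma> \<turnstile> EqType (El (code_Sum a b)) (Sum_ty (El a) (El b))"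
| code_Id: "\<lbrakk>\<Gamma> \<turnstile> HasType a U_ty; \<Gamma> \<turnstile> HasType t (El a); \<Gamma> \<turnstile> HasType u (El a)\<rbrakk>
    \<Longrightarrow> \<Gamma> \<turnstile> HasType (code_Id a t u) U_ty"
| code_Id_eq: "\<lbrakk>\<Gamma> \<turnstile> EqTerm a a' U_ty; \<Gamma> \<turnstile> EqTerm t t' (El a); \<Gamma> \<turnstile> EqTerm u u' (El a)\<rbrakk>
    \<Longrightarrow> \<Gamma> \<turnstile> EqTerm (code_Id a t u) (code_Id a' t' u') U_ty"
| El_Id: "\<lbrakk>\<Gamma> \<turnstile> HasType a U_ty; \<Gamma> \<turnstile> HasType t (El a); \<Gamma> \<turnstile> HasType u (El a)\<rbrakk>
    \<Longrightarrow> \<Gamma> \<turnstile> EqType (El (code_Id a t u)) (Id_ty (El a) t u)"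


section \<open>The type of structures for a signature\<close>

text \<open>\<open>Spare\<close> keeps the supply of variables infinite whatever the types of objects and arrows are.\<close>

datatype ('o, 'a) variable = ObjVar 'o | ArrVar 'a | Spare nat

definition app_tuple :: "'v \<Rightarrow> 'v list \<Rightarrow> 'v expr" where
  "app_tuple K qs = (if qs = [] then app star (Var K) else fold (\<lambda>q t. app (Var q) t) qs (Var K))"

text \<open>In what follows, \<open>Fs K\<close> is the increasing listing of \<open>K//L\<close> and \<open>Ks\<close> that of the objects.\<close>

definition arrow_var_type ::
  "('o, 'a) signature \<Rightarrow> ('o \<Rightarrow> 'a list) \<Rightarrow> 'a \<Rightarrow> ('o, 'a) variable expr" where
  "arrow_var_type L Fs f =
     El (app_tuple (ObjVar (arr_cod L f)) (map (\<lambda>p. ArrVar (arr_comp L p f)) (Fs (arr_cod L f))))"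

definition sort_type ::
  "('o, 'a) signature \<Rightarrow> ('o \<Rightarrow> 'a list) \<Rightarrow> 'o \<Rightarrow> ('o, 'a) variable expr" where
  "sort_type L Fs K =
     (if Fs K = [] then arrow_ty Unit_ty U_ty
      else foldr (\<lambda>f B. Pi_ty (arrow_var_type L Fs f) (bind (ArrVar f) B)) (Fs K) U_ty)"

text \<open>As in \<open>\<Sigma>(O : U)(A : O \<rightarrow> O \<rightarrow> U)\<close>, the last entry is itself the body of the
  innermost \<open>\<Sigma>\<close>; the empty iteration is the unit type.\<close>

fun iterated_Sigma :: "'v ctxt \<Rightarrow> 'v expr" where
  "iterated_Sigma [] = Unit_ty"
| "iterated_Sigma [(x, A)] = A"
| "iterated_Sigma ((x, A) # \<Delta>) = Sigma_ty A (bind x (iterated_Sigma \<Delta>))"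

definition Struc ::
  "('o, 'a) signature \<Rightarrow> 'o list \<Rightarrow> ('o \<Rightarrow> 'a list) \<Rightarrow> ('o, 'a) variable expr" where
  "Struc L Ks Fs = iterated_Sigma (map (\<lambda>K. (ObjVar K, sort_type L Fs K)) Ks)"

end

theory Submission
  imports Defs
begin

text \<open>Let \<open>f : K \<rightarrow> K'\<close> be a non-identity arrow. Each \<open>pf\<close> with \<open>p \<in> K'//L\<close> is again in \<open>K//L\<close>, and
  properness of the order puts it before \<open>f\<close>; likewise \<open>K'\<close> comes before \<open>K\<close>. So all variables in the
  type of \<open>f\<close> are already declared, and \<open>K'\<close> applied to the \<open>pf\<close> has type \<open>U\<close>: applying \<open>K'\<close> renames
  the bound \<open>p\<close> in \<open>T\<^bsub>K'\<^esub>\<close> to \<open>pf\<close>, and by associativity \<open>(qp)f = q(pf)\<close> this renaming takes the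
  declared type of \<open>p\<close> to that of \<open>pf\<close>.\<close>

section \<open>Locally closed expressions\<close>

text \<open>\<open>close_at\<close> leaves existing indices untouched, so a stray
  \<open>Bnd k\<close> would be confused with the index made from the closed variable. Local closure
  excludes this when closing is followed by opening.\<close>

fun lc_at :: "nat \<Rightarrow> 'v expr \<Rightarrow> bool" where
  "lc_at k (Var y) = True"
| "lc_at k (Bnd n) = (n < k)"
| "lc_at k (Abs e) = lc_at (Suc k) e"
| "lc_at k (Op c es) = (\<forall>e\<in>set es. lc_at k e)"

lemma lc_at_close_at: "lc_at k e \<Longrightarrow> lc_at (Suc k) (close_at k x e)"
  by (induction e arbitrary: k) auto

lemma lc_at_bind: "lc_at 0 e \<Longrightarrow> lc_at 0 (bind x e)"
  by (simp add: bind_def lc_at_close_at)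

text \<open>The renaming need not be injective: distinct arrows may have equal composites with \<open>f\<close>.\<close>

lemma open_at_map_expr_close_at:
  "lc_at k e \<Longrightarrow> open_at k (Var y) (map_expr \<rho> (close_at k x e)) = map_expr (\<rho>(x := y)) e"
  by (induction e arbitrary: k) auto

lemma lc_at_fold_app: "lc_at 0 t \<Longrightarrow> lc_at 0 (fold (\<lambda>q t. app (Var q) t) qs t)"
  by (induction qs arbitrary: t) auto

lemma lc_at_app_tuple: "lc_at 0 (app_tuple K qs)"
  by (simp add: app_tuple_def lc_at_fold_app)

lemma lc_at_foldr_Pi:
  assumes "\<And>f. f \<in> set fs \<Longrightarrow> lc_at 0 (A f)" "lc_at 0 B"
  shows "lc_at 0 (foldr (\<lambda>f B. Pi_ty (A f) (bind (x f) B)) fs B)"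
  using assms by (induction fs) (auto simp: lc_at_bind)

lemma map_expr_fold_app:
  "map_expr \<rho> (fold (\<lambda>q t. app (Var q) t) qs t) =
     fold (\<lambda>q t. app (Var q) t) (map \<rho> qs) (map_expr \<rho> t)"
  by (induction qs arbitrary: t) auto

lemma map_expr_app_tuple: "map_expr \<rho> (app_tuple K qs) = app_tuple (\<rho> K) (map \<rho> qs)"
  by (simp add: app_tuple_def map_expr_fold_app)

section \<open>Types over telescopes\<close>

text \<open>Each \<open>A f\<close> has to be a type only over the entries before it.
  \<open>\<Gamma>\<close> varies in the induction because the head entry moves from the telescope
  into the context.\<close>

lemma IsType_foldr_Pi:
  assumes "\<And>gs f hs. fs = gs @ f # hs \<Longrightarrow> \<Gamma> @ map (\<lambda>f. (x f, A f)) gs \<turnstile> IsType (A f)"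
    and "\<Gamma> @ map (\<lambda>f. (x f, A f)) fs \<turnstile> IsType B"
  shows "\<Gamma> \<turnstile> IsType (foldr (\<lambda>f B. Pi_ty (A f) (bind (x f) B)) fs B)"
  using assms
proof (induction fs arbitrary: \<Gamma>)
  case (Cons f fs)
  have "\<Gamma> \<turnstile> IsType (A f)"
    using Cons.prems(1)[of "[]" f fs] by simp
  moreover have "ext \<Gamma> (x f) (A f) \<turnstile> IsType (foldr (\<lambda>f B. Pi_ty (A f) (bind (x f) B)) fs B)"
  proof (rule Cons.IH)
    fix gs g hs assume "fs = gs @ g # hs"
    then show "ext \<Gamma> (x f) (A f) @ map (\<lambda>f. (x f, A f)) gs \<turnstile> IsType (A g)"
      using Cons.prems(1)[of "f # gs" g hs] by simp
  qed (use Cons.prems(2) in simp)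
  ultimately show ?case
    by (simp add: Pi_form)
qed simp

text \<open>Distinctness supplies the freshness that \<open>ctx_ext\<close> asks for whenever an
  entry moves into the context.\<close>

lemma IsType_iterated_Sigma:
  assumes "\<Gamma> \<turnstile> IsCtx"
    and "\<And>\<Delta>1 x A \<Delta>2. \<Delta> = \<Delta>1 @ (x, A) # \<Delta>2 \<Longrightarrow> \<Gamma> @ \<Delta>1 \<turnstile> IsType A"
    and "distinct (map fst (\<Gamma> @ \<Delta>))"
  shows "\<Gamma> \<turnstile> IsType (iterated_Sigma \<Delta>)"
  using assms
proof (induction \<Delta> arbitrary: \<Gamma> rule: iterated_Sigma.induct)
  case 1
  then show ?case by (simp add: Unit_form)
next
  case (2 x A)
  show ?case using "2.prems"(2)[of "[]" x A "[]"] by simp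
next
  case (3 x A yB \<Delta>)
  have A: "\<Gamma> \<turnstile> IsType A"
    using "3.prems"(2)[of "[]" x A "yB # \<Delta>"] by simp
  have "ext \<Gamma> x A \<turnstile> IsType (iterated_Sigma (yB # \<Delta>))"
  proof (rule "3.IH")
    show "ext \<Gamma> x A \<turnstile> IsCtx"
      using A "3.prems"(3) by (intro ctx_ext) auto
    fix \<Delta>1 y B \<Delta>2 assume "yB # \<Delta> = \<Delta>1 @ (y, B) # \<Delta>2"
    then show "ext \<Gamma> x A @ \<Delta>1 \<turnstile> IsType B"
      using "3.prems"(2)[of "(x, A) # \<Delta>1" y B \<Delta>2] by simp
  qed (use "3.prems"(3) in simp)
  with A show ?case
    by (simp add: Sigma_form)
qed

section \<open>Listed signatures\<close>

locale listed_folds_signature = folds_signature L for L :: "('o, 'a) signature" +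
  fixes Ks :: "'o list" and Fs :: "'o \<Rightarrow> 'a list"
  assumes Ks: "increasing_listing (obj_less L) (Obj L) Ks"
    and Fs: "K \<in> Obj L \<Longrightarrow> increasing_listing (arr_less L) (proper_arrows L K) (Fs K)"
begin

section \<open>Positions of composites and codomains in the listings\<close>

lemma set_Fs: "K \<in> Obj L \<Longrightarrow> set (Fs K) = proper_arrows L K"
  and distinct_Fs: "K \<in> Obj L \<Longrightarrow> distinct (Fs K)"
  using Fs by (auto simp: increasing_listing_def)

lemma proper_arrow_cod:
  assumes "f \<in> proper_arrows L K"
  shows "f \<in> Arr L" "arr_dom L f = K" "arr_cod L f \<in> Obj L" "obj_less L (arr_cod L f) K"
  using assms cod_less_dom[of f] cod_in by (auto simp: proper_arrows_def)

text \<open>Codomains strictly decrease: \<open>cod p < cod f < K\<close>. Hence the codomain of the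
  composite differs from \<open>K\<close>, which rules out the identity, and the comparison with
  \<open>f\<close> is decided by codomains.\<close>

lemma comp_proper_arrows:
  assumes K: "K \<in> Obj L" and f: "f \<in> proper_arrows L K"
    and p: "p \<in> proper_arrows L (arr_cod L f)"
  shows "arr_comp L p f \<in> proper_arrows L K" "arr_less L (arr_comp L p f) f"
proof -
  note f' = proper_arrow_cod[OF f] and p' = proper_arrow_cod[OF p]
  have arr: "arr_comp L p f \<in> Arr L" "arr_dom L (arr_comp L p f) = K"
    "arr_cod L (arr_comp L p f) = arr_cod L p"
    using f' p' by (simp_all add: comp_in dom_comp cod_comp)
  have "obj_less L (arr_cod L p) K"
    using obj_less_trans f' p' K by (meson transp_onD)
  then have "arr_cod L p \<noteq> K"
    using obj_less_irrefl K by (meson irreflp_onD)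
  then show "arr_comp L p f \<in> proper_arrows L K"
    using arr cod_ident[OF K] by (simp add: proper_arrows_def) metis
  show "arr_less L (arr_comp L p f) f"
    using arr f' p' by (intro arr_less_cod) auto
qed

text \<open>In a linear extension nothing after \<open>f\<close> lies below \<open>f\<close>. The
  composite is strictly below \<open>f\<close> and belongs to the listing, so only the part before
  \<open>f\<close> remains.\<close>

lemma comp_precedes:
  assumes K: "K \<in> Obj L" and split: "Fs K = fs @ f # fs'"
    and p: "p \<in> proper_arrows L (arr_cod L f)"
  shows "arr_comp L p f \<in> set fs"
proof -
  have f: "f \<in> proper_arrows L K"
    using split set_Fs[OF K] by auto
  note c = comp_proper_arrows[OF K f p]
  have "arr_comp L p f \<noteq> f"
    using c(2) proper_arrow_cod(1)[OF f] arr_less_irrefl by (metis irreflp_onD)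
  moreover have "arr_comp L p f \<notin> set fs'"
    using Fs[OF K] c(2) split by (auto simp: increasing_listing_def sorted_wrt_append)
  ultimately show ?thesis
    using c(1) set_Fs[OF K] split by auto
qed

lemma cod_precedes:
  assumes split: "Ks = Js @ K # Js'" and f: "f \<in> proper_arrows L K"
  shows "arr_cod L f \<in> set Js"
proof -
  note f' = proper_arrow_cod[OF f]
  have "arr_cod L f \<noteq> K"
    using f' obj_less_irrefl by (metis irreflp_onD)
  moreover have "arr_cod L f \<notin> set Js'"
    using Ks f'(4) split by (auto simp: increasing_listing_def sorted_wrt_append)
  moreover have "arr_cod L f \<in> set Ks"
    using Ks f'(3) by (simp add: increasing_listing_def)
  ultimately show ?thesis
    using split by auto
qed

section \<open>Renaming by precomposition with an arrow\<close>

definition precomp_var :: "'a \<Rightarrow> 'a list \<Rightarrow> ('o, 'a) variable \<Rightarrow> ('o, 'a) variable" where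
  "precomp_var f ps v =
     (case v of ArrVar p \<Rightarrow> ArrVar (if p \<in> set ps then arr_comp L p f else p) | _ \<Rightarrow> v)"

lemma precomp_var_Nil: "precomp_var f [] = id"
  by (auto simp: precomp_var_def fun_eq_iff split: variable.split)

text \<open>Here \<open>ps\<close> stands for the binders that have already received an argument.
  The renaming is simultaneous, so one more argument is a pointwise update, the form produced by
  \<open>open_at_map_expr_close_at\<close>.\<close>

lemma precomp_var_snoc:
  "precomp_var f (ps @ [p]) = (precomp_var f ps)(ArrVar p := ArrVar (arr_comp L p f))"
  by (auto simp: precomp_var_def fun_eq_iff split: variable.split)

text \<open>The arrow variables in the type of \<open>p\<close> are the composites
  \<open>qp\<close>. All of them lie in \<open>ps\<close> by \<open>comp_precedes\<close>, so each
  is renamed to \<open>(qp)f\<close>, which associativity turns into \<open>q(pf)\<close>.\<close>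

lemma map_expr_arrow_var_type:
  assumes f: "f \<in> Arr L" and split: "Fs (arr_cod L f) = ps @ p # qs"
  shows "map_expr (precomp_var f ps) (arrow_var_type L Fs p) = arrow_var_type L Fs (arr_comp L p f)"
proof -
  have K: "arr_cod L f \<in> Obj L"
    using f by (rule cod_in)
  have p: "p \<in> proper_arrows L (arr_cod L f)"
    using split set_Fs[OF K] by auto
  note p' = proper_arrow_cod[OF p]
  have "precomp_var f ps (ArrVar (arr_comp L q p)) = ArrVar (arr_comp L q (arr_comp L p f))"
    if "q \<in> set (Fs (arr_cod L p))" for q
  proof -
    have q: "q \<in> proper_arrows L (arr_cod L p)"
      using that set_Fs p'(3) by auto
    then show ?thesis
      using comp_precedes[OF K split q] comp_assoc[of f p q] f p' proper_arrow_cod[OF q]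
      by (simp add: precomp_var_def)
  qed
  moreover have "arr_cod L (arr_comp L p f) = arr_cod L p"
    using f p' by (simp add: cod_comp)
  moreover have "precomp_var f ps (ObjVar (arr_cod L p)) = ObjVar (arr_cod L p)"
    by (simp add: precomp_var_def)
  ultimately show ?thesis
    by (simp add: arrow_var_type_def map_expr_app_tuple comp_def cong: map_cong)
qed

section \<open>Formation of arrow types, sorts and the type of structures\<close>

lemma lc_at_arrow_var_type: "lc_at 0 (arrow_var_type L Fs f)"
  by (simp add: arrow_var_type_def lc_at_app_tuple)

lemma IsType_arrow_var_type:
  assumes \<Gamma>: "\<Gamma> \<turnstile> IsCtx" and f: "f \<in> Arr L"
    and sort: "(ObjVar (arr_cod L f), sort_type L Fs (arr_cod L f)) \<in> set \<Gamma>"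
    and args: "\<And>p. p \<in> set (Fs (arr_cod L f)) \<Longrightarrow>
      (ArrVar (arr_comp L p f), arrow_var_type L Fs (arr_comp L p f)) \<in> set \<Gamma>"
  shows "\<Gamma> \<turnstile> IsType (arrow_var_type L Fs f)"
proof -
  let ?K = "arr_cod L f"
  let ?Pi = "\<lambda>qs. foldr (\<lambda>f B. Pi_ty (arrow_var_type L Fs f) (bind (ArrVar f) B)) qs U_ty"
  let ?app = "\<lambda>ps. fold (\<lambda>q t. app (Var q) t) (map (\<lambda>p. ArrVar (arr_comp L p f)) ps) (Var (ObjVar ?K))"
  have head: "\<Gamma> \<turnstile> HasType (Var (ObjVar ?K)) (sort_type L Fs ?K)"
    using \<Gamma> sort by (rule var)
  have "\<Gamma> \<turnstile> HasType (app_tuple (ObjVar ?K) (map (\<lambda>p. ArrVar (arr_comp L p f)) (Fs ?K))) U_ty"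
  proof (cases "Fs ?K = []")
    case True
    with head have "\<Gamma> \<turnstile> HasType (Var (ObjVar ?K)) (Pi_ty Unit_ty (Abs U_ty))"
      by (simp add: sort_type_def)
    from Pi_elim[OF this Unit_intro[OF \<Gamma>]] True show ?thesis
      by (simp add: app_tuple_def)
  next
    case False
    \<comment> \<open>Invariant of partial application: after the arguments for \<open>ps\<close>,
      the type is the product over the remaining \<open>qs\<close>, renamed by
      \<open>precomp_var f ps\<close>. Induction adds arguments at the right because the last one is
      outermost in the left fold. At \<open>qs = []\<close> only \<open>U_ty\<close> is
      left.\<close>
    have "\<Gamma> \<turnstile> HasType (?app ps) (map_expr (precomp_var f ps) (?Pi qs))" if "Fs ?K = ps @ qs" for ps qs
      using that
    proof (induction ps arbitrary: qs rule: rev_induct)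
      case Nil
      with head False show ?case
        by (simp add: sort_type_def precomp_var_Nil id_def expr.map_ident)
    next
      case (snoc p ps)
      then have split: "Fs ?K = ps @ p # qs"
        by simp
      have fn: "\<Gamma> \<turnstile> HasType (?app ps) (Pi_ty (arrow_var_type L Fs (arr_comp L p f))
          (Abs (map_expr (precomp_var f ps) (close_at 0 (ArrVar p) (?Pi qs)))))"
        using snoc.IH[OF split] map_expr_arrow_var_type[OF f split] by (simp add: bind_def)
      have arg: "\<Gamma> \<turnstile> HasType (Var (ArrVar (arr_comp L p f))) (arrow_var_type L Fs (arr_comp L p f))"
        using \<Gamma> args split by (intro var) auto
      have "lc_at 0 (?Pi qs)"
        by (intro lc_at_foldr_Pi lc_at_arrow_var_type) auto
      with Pi_elim[OF fn arg] show ?case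
        by (simp add: open_at_map_expr_close_at precomp_var_snoc fun_upd_def)
    qed
    from this[of "Fs ?K" "[]"] False show ?thesis
      by (simp add: app_tuple_def)
  qed
  then show ?thesis
    unfolding arrow_var_type_def by (rule El_form)
qed

lemma IsType_sort_type:
  assumes \<Gamma>: "\<Gamma> \<turnstile> IsCtx" and K: "K \<in> Obj L"
    and fresh: "fst ` set \<Gamma> \<subseteq> range ObjVar"
    and sorts: "\<And>f. f \<in> proper_arrows L K \<Longrightarrow>
      (ObjVar (arr_cod L f), sort_type L Fs (arr_cod L f)) \<in> set \<Gamma>"
  shows "\<Gamma> \<turnstile> IsType (sort_type L Fs K)"
proof (cases "Fs K = []")
  case True
  have unit: "\<Gamma> \<turnstile> IsType Unit_ty"
    using \<Gamma> by (rule Unit_form)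
  \<comment> \<open>\<open>Spare 0\<close> names the dummy argument. It is fresh since
    \<open>\<Gamma>\<close> declares only object variables, and binding it in \<open>U_ty\<close>
    gives the constant family of \<open>arrow_ty\<close>.\<close>
  moreover have "ext \<Gamma> (Spare 0) Unit_ty \<turnstile> IsCtx"
    using unit fresh by (intro ctx_ext) auto
  ultimately have "\<Gamma> \<turnstile> IsType (Pi_ty Unit_ty (bind (Spare 0) U_ty))"
    by (intro Pi_form U_form)
  with True show ?thesis
    by (simp add: sort_type_def bind_def)
next
  case False
  define \<Delta> where "\<Delta> = (\<lambda>fs. \<Gamma> @ map (\<lambda>f. (ArrVar f, arrow_var_type L Fs f)) fs)"
  \<comment> \<open>Typing an arrow variable needs a well-formed prefix, and extending the prefix
    needs that type. So \<open>type\<close> assumes the context, and the induction for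
    \<open>ctx\<close> discharges this assumption.\<close>
  have type: "\<Delta> fs \<turnstile> IsType (arrow_var_type L Fs f)"
    if split: "Fs K = fs @ f # fs'" and ctx: "\<Delta> fs \<turnstile> IsCtx" for fs f fs'
  proof -
    have f: "f \<in> proper_arrows L K"
      using split set_Fs[OF K] by auto
    show ?thesis
      using ctx
    proof (rule IsType_arrow_var_type)
      show "f \<in> Arr L"
        using proper_arrow_cod[OF f] by simp
      show "(ObjVar (arr_cod L f), sort_type L Fs (arr_cod L f)) \<in> set (\<Delta> fs)"
        using sorts[OF f] by (simp add: \<Delta>_def)
      fix p assume "p \<in> set (Fs (arr_cod L f))"
      then have "arr_comp L p f \<in> set fs"
        using comp_precedes[OF K split] set_Fs proper_arrow_cod(3)[OF f] by simp
      then show "(ArrVar (arr_comp L p f), arrow_var_type L Fs (arr_comp L p f)) \<in> set (\<Delta> fs)"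
        by (auto simp: \<Delta>_def)
    qed
  qed
  have ctx: "\<Delta> fs \<turnstile> IsCtx" if "Fs K = fs @ fs'" for fs fs'
    using that
  proof (induction fs arbitrary: fs' rule: rev_induct)
    case Nil
    show ?case using \<Gamma> by (simp add: \<Delta>_def)
  next
    case (snoc f fs)
    then have split: "Fs K = fs @ f # fs'"
      by simp
    have "ArrVar f \<notin> fst ` set (\<Delta> fs)"
      using fresh distinct_Fs[OF K] split by (auto simp: \<Delta>_def)
    from ctx_ext[OF type[OF split snoc.IH[OF split]] this] show ?case
      by (simp add: \<Delta>_def)
  qed
  have "\<Gamma> \<turnstile> IsType (foldr (\<lambda>f B. Pi_ty (arrow_var_type L Fs f) (bind (ArrVar f) B)) (Fs K) U_ty)"
  proof (rule IsType_foldr_Pi)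
    fix gs f hs assume "Fs K = gs @ f # hs"
    then show "\<Gamma> @ map (\<lambda>f. (ArrVar f, arrow_var_type L Fs f)) gs \<turnstile> IsType (arrow_var_type L Fs f)"
      using type ctx unfolding \<Delta>_def by blast
  next
    show "\<Gamma> @ map (\<lambda>f. (ArrVar f, arrow_var_type L Fs f)) (Fs K) \<turnstile> IsType U_ty"
      using ctx[of "Fs K" "[]"] by (intro U_form) (simp add: \<Delta>_def)
  qed
  with False show ?thesis
    by (simp add: sort_type_def)
qed

text \<open>The same alternation of \<open>type\<close> and \<open>ctx\<close> as for a single sort,
  now along the objects, with \<open>cod_precedes\<close> providing the declarations each sort
  refers to.\<close>

lemma IsType_Struc: "[] \<turnstile> IsType (Struc L Ks Fs)"
proof -
  define \<Gamma> where "\<Gamma> = map (\<lambda>K. (ObjVar K :: ('o, 'a) variable, sort_type L Fs K))"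
  have dist: "distinct Ks" and set_Ks: "set Ks = Obj L"
    using Ks by (auto simp: increasing_listing_def)
  have type: "\<Gamma> Js \<turnstile> IsType (sort_type L Fs K)"
    if split: "Ks = Js @ K # Js'" and ctx: "\<Gamma> Js \<turnstile> IsCtx" for Js K Js'
    using ctx
  proof (rule IsType_sort_type)
    show "K \<in> Obj L"
      using split set_Ks by auto
    show "fst ` set (\<Gamma> Js) \<subseteq> range ObjVar"
      by (auto simp: \<Gamma>_def)
    fix f assume "f \<in> proper_arrows L K"
    from cod_precedes[OF split this]
    show "(ObjVar (arr_cod L f), sort_type L Fs (arr_cod L f)) \<in> set (\<Gamma> Js)"
      by (auto simp: \<Gamma>_def)
  qed
  have ctx: "\<Gamma> Js \<turnstile> IsCtx" if "Ks = Js @ Js'" for Js Js'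
    using that
  proof (induction Js arbitrary: Js' rule: rev_induct)
    case Nil
    show ?case by (simp add: \<Gamma>_def ctx_empty)
  next
    case (snoc K Js)
    then have split: "Ks = Js @ K # Js'"
      by simp
    have "ObjVar K \<notin> fst ` set (\<Gamma> Js)"
      using dist split by (auto simp: \<Gamma>_def)
    from ctx_ext[OF type[OF split snoc.IH[OF split]] this] show ?case
      by (simp add: \<Gamma>_def)
  qed
  have "[] \<turnstile> IsType (iterated_Sigma (\<Gamma> Ks))"
  proof (rule IsType_iterated_Sigma)
    fix \<Delta>1 x A \<Delta>2 assume "\<Gamma> Ks = \<Delta>1 @ (x, A) # \<Delta>2"
    then obtain Js K Js' where "Ks = Js @ K # Js'" "\<Delta>1 = \<Gamma> Js" "A = sort_type L Fs K"
      unfolding \<Gamma>_def by (auto simp: map_eq_append_conv map_eq_Cons_conv)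
    then show "[] @ \<Delta>1 \<turnstile> IsType A"
      using type ctx by simp
  next
    show "distinct (map fst ([] @ \<Gamma> Ks))"
      using dist by (auto simp: \<Gamma>_def distinct_map inj_on_def)
  qed (rule ctx_empty)
  then show ?thesis
    by (simp add: Struc_def \<Gamma>_def)
qed

end

theorem theorem2p9:
  fixes L :: "('o, 'a) signature" and Ks :: "'o list" and Fs :: "'o \<Rightarrow> 'a list"
  assumes "finite_folds_signature L"
    and "increasing_listing (obj_less L) (Obj L) Ks"
    and "\<And>K. K \<in> Obj L \<Longrightarrow> increasing_listing (arr_less L) (proper_arrows L K) (Fs K)"
  shows "[] \<turnstile> IsType (Struc L Ks Fs)"
proof -
  interpret finite_folds_signature L
    by fact
  interpret listed_folds_signature L Ks Fs
    by unfold_locales (use assms in auto)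
  show ?thesis
    by (rule IsType_Struc)
qed

end
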